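(* Let $\mathcal X$ be a nonempty compact convex subset of a Euclidean space, let $d\ge1$ be the dimension of its affine hull, and let $\mu$ be the uniform probability measure on $\mathcal X$ (normalized $d$-dimensional Lebesgue measure restricted to $\mathcal X$). For every $T\ge1$ and every (possibly adaptively chosen) sequence of continuous convex losses $f_1,\dots,f_T:\mathcal X\to[-1,1]$, the continuous alternation-aware Hedge algorithm with reference distribution $\mu$ (defined in the context) guarantees $$\max_{u\in\mathcal X}\mathrm{Reg}_{\mathrm{Alt}}^T(u)\le 8d\left(1+\log_+\frac{T}{2d}\right)+\frac14,$$ where $\log_+z=\max\{0,\log z\}$. Consequently (as $\max_{u}\mathrm{Reg}_{\mathrm{Alt}}^T(u)\le 4T$ trivially), with absolute implied constants, $$\max_{u\in\mathcal X}\mathrm{Reg}_{\mathrm{Alt}}^T(u)=O\left(\min\left\{T,\ d\left(1+\log_+\frac{T}{2d}\right)\right\}\right)=O\bigl(d\log(1+T/d)\bigr).$$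
   Context: In round $t\ge1$ the learner chooses $x_t\in\mathcal X$ using $f_1,\dots,f_{t-1}$; then $f_t$ is chosen (possibly depending on $x_1,\dots,x_t$) and revealed. With $f_0\equiv0$ and $g_t=f_{t-1}+f_t$, the alternating regret to $u\in\mathcal X$ is $\mathrm{Reg}_{\mathrm{Alt}}^T(u)=\sum_{t=1}^T(g_t(x_t)-g_t(u))$. Continuous alternation-aware Hedge with reference Borel probability measure $\mu$ on $\mathcal X$: set $\eta=1/8$, $\beta=1/32$, $L_0\equiv0$. For $t=1,2,\dots$: (1) let $\theta_t$ be the unique maximizer over $\theta\in\mathbb R$ of $\log\int_{\mathcal X}\exp[-\eta L_{t-1}(u)-\beta(f_{t-1}(u)-\theta)^2]\,\mu(\mathrm du)$; (2) set $\xi_t(u)=f_{t-1}(u)-\theta_t$ and let $P_t$ be the probability measure with $P_t(\mathrm du)\propto\exp[-\eta L_{t-1}(u)-\beta\xi_t(u)^2]\,\mu(\mathrm du)$; (3) set $Q_t(\mathrm du)=(1-\xi_t(u)/2)P_t(\mathrm du)$, which is a probability measure; (4) play $x_t=\int_{\mathcal X}u\,Q_t(\mathrm du)$; (5) observe $f_t$ and set $L_t=L_{t-1}+f_{t-1}+f_t$. *)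

theory Defs
  imports "HOL-Analysis.Analysis"
begin

section \<open>Uniform distribution on a convex body of arbitrary affine dimension\<close>

definition affine_frame :: "'a::euclidean_space set \<Rightarrow> 'a \<Rightarrow> 'a set \<Rightarrow> bool" where
  "affine_frame S a B \<longleftrightarrow>
     pairwise orthogonal B \<and> (\<forall>b\<in>B. norm b = 1) \<and> affine hull S = (+) a ` span B"

text \<open>
  Lebesgue measure of dimension \<open>card B\<close> on the affine subspace \<open>a + span B\<close>, as a Borel
  measure on the ambient space: the image of the product Lebesgue measure under the isometric
  parametrisation given by the orthonormal set \<open>B\<close>.
\<close>

definition affine_lborel :: "'a::euclidean_space \<Rightarrow> 'a set \<Rightarrow> 'a measure" where
  "affine_lborel a B = distr (Pi\<^sub>M B (\<lambda>_. lborel)) borel (\<lambda>y. a + (\<Sum>b\<in>B. y b *\<^sub>R b))"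

lemma affine_lborel_Basis:
  "affine_lborel 0 Basis = (lborel :: 'a::euclidean_space measure)"
  unfolding affine_lborel_def by (simp add: lborel_eq[symmetric])

text \<open>
  The measure \<open>\<mu>\<close> lives on the space \<open>X\<close> with its Borel sets, so that functions
  are integrated against it irrespective of their values outside \<open>X\<close>. By rotation and
  translation invariance of Lebesgue measure the choice of frame does not matter.
\<close>

definition uniform_on :: "'a::euclidean_space set \<Rightarrow> 'a measure \<Rightarrow> bool" where
  "uniform_on X \<mu> \<longleftrightarrow>
     (\<exists>a B. affine_frame X a B \<and> \<mu> = restrict_space (uniform_measure (affine_lborel a B) X) X)"

lemma affine_frame_exists:
  fixes X :: "'a::euclidean_space set"
  assumes "X \<noteq> {}"
  obtains a B where "affine_frame X a B" "int (card B) = aff_dim X"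
proof -
  obtain a where a: "a \<in> X" using assms by auto
  let ?S = "(\<lambda>x. - a + x) ` (affine hull X)"
  have aH: "a \<in> affine hull X" using a by (simp add: hull_inc)
  have sub: "subspace ?S"
    using affine_diffs_subspace[OF affine_affine_hull aH] by simp
  obtain B where B: "B \<subseteq> ?S" "pairwise orthogonal B" "\<And>x. x \<in> B \<Longrightarrow> norm x = 1"
    "independent B" "card B = dim ?S" "span B = ?S"
    using orthonormal_basis_subspace[OF sub] by metis
  have "affine hull X = (+) a ` span B"
    unfolding B(6) by (simp add: image_image)
  moreover have "int (card B) = aff_dim X"
    using aff_dim_dim_affine_diffs[OF affine_affine_hull[of X] aH] B(5)
    by (simp add: uminus_add_conv_diff)
  ultimately show thesis using that[of a B] B unfolding affine_frame_def by blast
qed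

lemma uniform_on_exists:
  assumes "X \<noteq> {}"
  shows "\<exists>\<mu>. uniform_on X \<mu>"
  using affine_frame_exists[OF assms] unfolding uniform_on_def by metis


section \<open>Alternation-aware Hedge\<close>

text \<open>
  A sequence \<open>f\<close> of losses is indexed from \<open>0\<close>, where \<open>f 0\<close> is the fictitious
  zero loss. Rounds \<open>t\<close> start at \<open>1\<close>; the point played in round \<open>t\<close> depends on
  \<open>f 0, \<dots>, f (t - 1)\<close> only.
\<close>

definition hedge_eta :: real where "hedge_eta = 1/8"

definition hedge_beta :: real where "hedge_beta = 1/32"

primrec cum_loss :: "(nat \<Rightarrow> 'a \<Rightarrow> real) \<Rightarrow> nat \<Rightarrow> 'a \<Rightarrow> real" where
  "cum_loss f 0 u = 0"
| "cum_loss f (Suc t) u = cum_loss f t u + f t u + f (Suc t) u"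

definition hedge_weight :: "(nat \<Rightarrow> 'a \<Rightarrow> real) \<Rightarrow> nat \<Rightarrow> real \<Rightarrow> 'a \<Rightarrow> real" where
  "hedge_weight f t \<theta> u =
     exp (- hedge_eta * cum_loss f (t - 1) u - hedge_beta * (f (t - 1) u - \<theta>)\<^sup>2)"

definition hedge_theta :: "'a measure \<Rightarrow> (nat \<Rightarrow> 'a \<Rightarrow> real) \<Rightarrow> nat \<Rightarrow> real" where
  "hedge_theta \<mu> f t =
     (THE \<theta>. is_arg_max (\<lambda>\<theta>. ln (\<integral>u. hedge_weight f t \<theta> u \<partial>\<mu>)) (\<lambda>_. True) \<theta>)"

definition hedge_xi :: "'a measure \<Rightarrow> (nat \<Rightarrow> 'a \<Rightarrow> real) \<Rightarrow> nat \<Rightarrow> 'a \<Rightarrow> real" where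
  "hedge_xi \<mu> f t u = f (t - 1) u - hedge_theta \<mu> f t"

definition hedge_P :: "'a measure \<Rightarrow> (nat \<Rightarrow> 'a \<Rightarrow> real) \<Rightarrow> nat \<Rightarrow> 'a measure" where
  "hedge_P \<mu> f t =
     density \<mu> (\<lambda>u. ennreal (hedge_weight f t (hedge_theta \<mu> f t) u
                          / (\<integral>v. hedge_weight f t (hedge_theta \<mu> f t) v \<partial>\<mu>)))"

text \<open>
  For losses in \<open>[-1, 1]\<close> the maximizer \<open>\<theta>\<close> lies in \<open>[-1, 1]\<close>, hence
  \<open>\<xi>\<close> is at most \<open>2\<close> and \<^const>\<open>ennreal\<close> does not truncate.
\<close>

definition hedge_Q :: "'a measure \<Rightarrow> (nat \<Rightarrow> 'a \<Rightarrow> real) \<Rightarrow> nat \<Rightarrow> 'a measure" where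
  "hedge_Q \<mu> f t = density (hedge_P \<mu> f t) (\<lambda>u. ennreal (1 - hedge_xi \<mu> f t u / 2))"

definition hedge_play :: "'a::euclidean_space measure \<Rightarrow> (nat \<Rightarrow> 'a \<Rightarrow> real) \<Rightarrow> nat \<Rightarrow> 'a" where
  "hedge_play \<mu> f t = (\<integral>u. u \<partial>(hedge_Q \<mu> f t))"


section \<open>Alternating regret\<close>

definition alt_loss :: "(nat \<Rightarrow> 'a \<Rightarrow> real) \<Rightarrow> nat \<Rightarrow> 'a \<Rightarrow> real" where
  "alt_loss f t u = f (t - 1) u + f t u"

definition alt_regret :: "(nat \<Rightarrow> 'a \<Rightarrow> real) \<Rightarrow> (nat \<Rightarrow> 'a) \<Rightarrow> nat \<Rightarrow> 'a \<Rightarrow> real" where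
  "alt_regret f x T u = (\<Sum>t=1..T. alt_loss f t (x t) - alt_loss f t u)"

definition log_plus :: "real \<Rightarrow> real" where
  "log_plus z = max 0 (ln z)"

end

(*
  Let Z_t(theta) be the integral of the hedge weights of round t, and put a = f_{t-1} - theta_t and
  b = f_t - theta'. Since theta_t maximizes Z_t, the function a has P_t-mean zero. The elementary
  inequality exp(-(a+b)/8 + (a^2-b^2)/32) <= 1 - (a+b)(1-a/2)/8 on the relevant range, integrated
  against P_t, says that ln Z_t(theta_t) - ln Z_{t+1}(theta') is at least eta times the Q_t-mean of
  f_{t-1} + f_t, hence, by Jensen, at least eta times the alternating loss of x_t. The sum over t
  telescopes to -ln Z_{T+1}(0). For a comparator p, the copy (1-eps) p + eps X of X has measure
  eps^d, and on it convexity bounds the cumulative loss by that of p plus 4 eps T; this bounds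
  Z_{T+1}(0) from below, and eps = min 1 (2d/T) gives the regret bound.
*)

theory Submission
  imports Defs "HOL-Probability.Probability_Measure"
begin

section \<open>Elementary inequalities\<close>

text \<open>The constants come from one identity: with \<open>s = a + b\<close>, the exponent in the
  elementary inequality is \<open>- s * (1 - a / 2) / 8 - s\<^sup>2 / 32\<close>. Replacing one
  Gaussian penalty by the next thus yields both the tilt \<open>1 - a / 2\<close> of Q_t and a
  quadratic reserve that pays for the second-order error of the exponential. The ratio \<beta> =
  \<eta> / 4 produces exactly this tilt, and \<eta> = 1/8 makes the reserve equal to the
  second-order term at the extreme value \<open>a = - 2\<close>. Maximality of theta_t enters
  through the bound by 1 and through the vanishing mean, which gives Q_t total mass one. Since
  theta_t is a definite description, uniqueness of the maximizer is part of the proof. A mixture of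
  Gaussians can have several modes; here all losses lie in [-1, 1] and the Gaussians are so wide
  that each of them is concave in \<theta> on that interval, while no maximizer lies outside it. The
  body may have empty interior in the ambient space, so its volume is computed in orthonormal
  coordinates of its affine hull.\<close>

lemma exp_minus_half_square_le:
  fixes y :: real
  assumes "0 \<le> y"
  shows "exp (y - y\<^sup>2 / 2) \<le> 1 + y"
proof -
  define h where "h y = ln (1 + y) - y + y\<^sup>2 / 2" for y :: real
  have "h 0 \<le> h y"
  proof (rule DERIV_nonneg_imp_nondecreasing[OF assms])
    fix z :: real assume z: "0 \<le> z" "z \<le> y"
    have "(h has_real_derivative 1 / (1 + z) - 1 + z) (at z)"
      unfolding h_def using z by (auto intro!: derivative_eq_intros)
    moreover have "1 / (1 + z) - 1 + z = z\<^sup>2 / (1 + z)"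
      using z by (simp add: field_simps power2_eq_square)
    ultimately show "\<exists>d. (h has_real_derivative d) (at z) \<and> 0 \<le> d"
      using z by auto
  qed
  then have "y - y\<^sup>2 / 2 \<le> ln (1 + y)" by (simp add: h_def)
  then show ?thesis using assms by (simp add: ln_ge_iff)
qed

lemma exp_minus_square_le_one_minus:
  fixes y :: real
  assumes "0 \<le> y" "y < 1"
  shows "exp (- y - y\<^sup>2 / (2 * (1 - y))) \<le> 1 - y"
proof -
  define h where "h y = ln (1 - y) + y + y\<^sup>2 / (2 * (1 - y))" for y :: real
  have "h 0 \<le> h y"
  proof (rule DERIV_nonneg_imp_nondecreasing[OF assms(1)])
    fix z :: real assume z: "0 \<le> z" "z \<le> y"
    let ?D = "- 1 / (1 - z) + 1 + (2 * z * (2 * (1 - z)) - z\<^sup>2 * (- 2)) / (2 * (1 - z))\<^sup>2"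
    have "(h has_real_derivative ?D) (at z)"
      unfolding h_def using z assms
      by (auto intro!: derivative_eq_intros simp: power2_eq_square)
    moreover have "?D = z\<^sup>2 / (2 * (1 - z)\<^sup>2)"
      using z assms by (simp add: divide_simps) (simp add: algebra_simps power2_eq_square)
    ultimately show "\<exists>d. (h has_real_derivative d) (at z) \<and> 0 \<le> d"
      by auto
  qed
  then have "- y - y\<^sup>2 / (2 * (1 - y)) \<le> ln (1 - y)" by (simp add: h_def)
  then show ?thesis using assms by (simp add: ln_ge_iff)
qed

text \<open>After the exponent is rewritten as \<open>- y - s\<^sup>2 / 32\<close>, what remains is
  to bound the gap between \<open>- y\<close> and \<open>ln (1 - y)\<close> by
  \<open>s\<^sup>2 / 32\<close>. The two signs of \<open>y\<close> call for the two preceding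
  bounds.\<close>

lemma exp_tilted_le:
  fixes a b :: real
  assumes a: "- 2 \<le> a" "a \<le> 2" and b: "b \<le> 2"
  shows "exp (- (a + b) / 8 + (a\<^sup>2 - b\<^sup>2) / 32) \<le> 1 - (a + b) * (1 - a / 2) / 8"
proof -
  define s where "s = a + b"
  define y where "y = s * (1 - a / 2) / 8"
  have X: "- (a + b) / 8 + (a\<^sup>2 - b\<^sup>2) / 32 = - y - s\<^sup>2 / 32"
    by (simp add: y_def s_def field_simps power2_eq_square)
  show ?thesis
  proof (cases "0 \<le> y")
    case True
    \<comment> \<open>The error \<open>y\<^sup>2 / (2 * (1 - y))\<close> is harmless only if
      \<open>y\<close> stays away from 1, which the bound on \<open>b\<close> ensures. The
      comparison that results, \<open>(2 - a)\<^sup>2 \<le> 12 + a\<^sup>2\<close>, amounts to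
      \<open>- 2 \<le> a\<close>.\<close>
    have "s \<le> 2 + a" using b by (simp add: s_def)
    then have "y \<le> (2 + a) * (1 - a / 2) / 8"
      unfolding y_def using a by (intro divide_right_mono mult_right_mono) auto
    also have "\<dots> = (4 - a\<^sup>2) / 16" by (simp add: field_simps power2_eq_square)
    finally have y_le: "y \<le> (4 - a\<^sup>2) / 16" .
    then have y1: "(12 + a\<^sup>2) / 16 \<le> 1 - y" by simp
    have pos: "0 < (12 + a\<^sup>2) / 16" by (simp add: add_pos_nonneg)
    have "y\<^sup>2 / (2 * (1 - y)) \<le> y\<^sup>2 / (2 * ((12 + a\<^sup>2) / 16))"
      using y1 pos by (intro divide_left_mono mult_pos_pos) auto
    also have "\<dots> = (s\<^sup>2 / 32) * ((2 - a)\<^sup>2 / (12 + a\<^sup>2))"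
      using pos by (simp add: y_def field_simps power2_eq_square)
    also have "\<dots> \<le> (s\<^sup>2 / 32) * 1"
    proof (rule mult_left_mono)
      have "(2 - a)\<^sup>2 \<le> 12 + a\<^sup>2" using a by (simp add: power2_eq_square algebra_simps)
      then show "(2 - a)\<^sup>2 / (12 + a\<^sup>2) \<le> 1" using pos by simp
    qed simp
    finally have "exp (- y - s\<^sup>2 / 32) \<le> exp (- y - y\<^sup>2 / (2 * (1 - y)))" by simp
    also have "\<dots> \<le> 1 - y"
      using True y1 pos by (intro exp_minus_square_le_one_minus) linarith+
    finally show ?thesis unfolding X by (simp add: y_def s_def)
  next
    case False
    have "(1 - a / 2)\<^sup>2 \<le> 2\<^sup>2" using a by (intro power_mono) auto
    then have "s\<^sup>2 * (1 - a / 2)\<^sup>2 \<le> s\<^sup>2 * 4" by (intro mult_left_mono) auto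
    then have "y\<^sup>2 / 2 \<le> s\<^sup>2 / 32"
      unfolding y_def power_divide power_mult_distrib by simp
    then have "exp (- y - s\<^sup>2 / 32) \<le> exp (- y - (- y)\<^sup>2 / 2)" by simp
    also have "\<dots> \<le> 1 + (- y)" using False by (intro exp_minus_half_square_le) simp
    finally show ?thesis unfolding X by (simp add: y_def s_def)
  qed
qed

text \<open>A weak form of \<open>cosh x \<le> exp (x\<^sup>2 / 2)\<close> that follows from
  quadratic bounds on both exponentials; \<open>gaussian_midpoint\<close> has room for the lost
  factor.\<close>

lemma exp_add_exp_le_two_exp_square:
  fixes x :: real
  assumes "\<bar>x\<bar> \<le> 1"
  shows "exp x + exp (- x) \<le> 2 * exp (x\<^sup>2)"
proof -
  have *: "exp x + exp (- x) \<le> 2 * exp (x\<^sup>2)" if "0 \<le> x" "x \<le> 1" for x :: real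
  proof -
    have "exp (- x) \<le> 1 - x + x\<^sup>2"
    proof -
      have "exp (- x) = 1 / exp x" by (simp add: exp_minus inverse_eq_divide)
      also have "\<dots> \<le> 1 / (1 + x)"
        using that by (intro divide_left_mono) auto
      also have "\<dots> \<le> 1 - x + x\<^sup>2"
      proof -
        have "1 \<le> 1 + x * x\<^sup>2" using that by simp
        also have "\<dots> = (1 - x + x\<^sup>2) * (1 + x)" by (simp add: algebra_simps power2_eq_square)
        finally show ?thesis using that by (simp add: divide_le_eq)
      qed
      finally show ?thesis .
    qed
    moreover have "exp x \<le> 1 + x + x\<^sup>2" using exp_bound that by blast
    moreover have "1 + x\<^sup>2 \<le> exp (x\<^sup>2)" by (rule exp_ge_add_one_self)
    ultimately show ?thesis by linarith
  qed
  show ?thesis using *[of x] *[of "- x"] assms by (cases "0 \<le> x") auto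
qed

text \<open>Expanding the squares leaves \<open>exp (- \<beta> * \<delta>\<^sup>2)\<close> times a
  hyperbolic cosine of \<open>2 * \<beta> * m * \<delta>\<close>. Since
  \<open>\<beta> * m\<^sup>2 \<le> 1 / 8\<close>, the cosine uses up at most half of the exponent.
  The surviving gain does not depend on \<open>m\<close>, so it can be taken out of an
  integral.\<close>

lemma gaussian_midpoint:
  fixes m \<delta> \<beta> :: real
  assumes \<beta>: "0 < \<beta>" "\<beta> \<le> 1 / 32" and m: "\<bar>m\<bar> \<le> 2" and \<delta>: "\<bar>\<delta>\<bar> \<le> 1"
  shows "exp (- \<beta> * (m - \<delta>)\<^sup>2) + exp (- \<beta> * (m + \<delta>)\<^sup>2) \<le> 2 * exp (- \<beta> * \<delta>\<^sup>2 / 2) * exp (- \<beta> * m\<^sup>2)"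
proof -
  define x where "x = 2 * \<beta> * m * \<delta>"
  have "\<bar>m\<bar> * \<bar>\<delta>\<bar> \<le> 2 * 1" using m \<delta> by (intro mult_mono) auto
  then have "\<beta> * (\<bar>m\<bar> * \<bar>\<delta>\<bar>) \<le> 1 / 32 * 2" using \<beta> by (intro mult_mono) auto
  then have x1: "\<bar>x\<bar> \<le> 1" using \<beta> by (simp add: x_def abs_mult)
  have "m\<^sup>2 \<le> 2\<^sup>2" using power_mono[OF m, of 2] by simp
  then have "\<beta> * m\<^sup>2 \<le> 1 / 32 * 4" using \<beta> by (intro mult_mono) auto
  then have "(4 * \<beta> * \<delta>\<^sup>2) * (\<beta> * m\<^sup>2) \<le> (4 * \<beta> * \<delta>\<^sup>2) * (1 / 8)"
    using \<beta> by (intro mult_left_mono) auto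
  then have x2: "x\<^sup>2 \<le> \<beta> * \<delta>\<^sup>2 / 2"
    by (simp add: x_def power2_eq_square mult_ac)
  have "exp (- \<beta> * (m - \<delta>)\<^sup>2) + exp (- \<beta> * (m + \<delta>)\<^sup>2)
      = exp (- \<beta> * m\<^sup>2) * exp (- \<beta> * \<delta>\<^sup>2) * (exp x + exp (- x))"
    unfolding distrib_left exp_add[symmetric] x_def
    by (simp add: algebra_simps power2_eq_square)
  also have "\<dots> \<le> exp (- \<beta> * m\<^sup>2) * exp (- \<beta> * \<delta>\<^sup>2) * (2 * exp (\<beta> * \<delta>\<^sup>2 / 2))"
    using order_trans[OF exp_add_exp_le_two_exp_square[OF x1]] x2 by (intro mult_left_mono) auto
  also have "\<dots> = 2 * (exp (- \<beta> * \<delta>\<^sup>2) * exp (\<beta> * \<delta>\<^sup>2 / 2)) * exp (- \<beta> * m\<^sup>2)"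
    by (simp add: mult_ac)
  also have "exp (- \<beta> * \<delta>\<^sup>2) * exp (\<beta> * \<delta>\<^sup>2 / 2) = exp (- \<beta> * \<delta>\<^sup>2 / 2)"
    by (simp add: exp_add[symmetric])
  finally show ?thesis .
qed

text \<open>Used with \<open>z = T / d\<close> to reach the closed form of the rate. Below 1 the
  linear branch is compared with \<open>ln (1 + z) \<ge> z / (1 + z)\<close>; above 1 the other
  branch suffices because \<open>ln 2 \<ge> 1 / 2\<close>.\<close>

lemma min_le_two_ln_add_one:
  fixes z :: real
  assumes "0 < z"
  shows "min z (1 + log_plus (z / 2)) \<le> 2 * ln (1 + z)"
proof -
  have ln2: "1 / 2 \<le> ln (2::real)" using ln2_ge_two_thirds by simp
  consider "z \<le> 1" | "1 \<le> z" "z \<le> 2" | "2 \<le> z" by linarith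
  then show ?thesis
  proof cases
    case 1
    have "1 - 1 / (1 + z) \<le> ln (1 + z)"
      using ln_le_minus_one[of "1 / (1 + z)"] assms by (simp add: ln_div)
    moreover have "z / 2 \<le> 1 - 1 / (1 + z)"
      using 1 assms by (simp add: field_simps)
    ultimately show ?thesis by simp
  next
    case 2
    then have "log_plus (z / 2) = 0" by (simp add: log_plus_def)
    moreover have "ln 2 \<le> ln (1 + z)" using 2 by simp
    ultimately show ?thesis using ln2 by simp
  next
    case 3
    have "log_plus (z / 2) = ln z - ln 2" using 3 by (simp add: log_plus_def ln_div)
    moreover have "ln z \<le> ln (1 + z)" "ln 2 \<le> ln (1 + z)" using 3 by auto
    ultimately show ?thesis using ln2 by simp
  qed
qed

section \<open>Jensen's inequality in Euclidean space\<close>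

text \<open>Serves twice: for the decision set it says that the play is feasible, for an epigraph it
  is Jensen's inequality.\<close>

lemma (in prob_space) mean_mem_closed_convex:
  fixes Y :: "'a \<Rightarrow> 'b::euclidean_space"
  assumes S: "convex S" "closed S" and Y: "integrable M Y" and mem: "\<And>u. u \<in> space M \<Longrightarrow> Y u \<in> S"
  shows "(\<integral>u. Y u \<partial>M) \<in> S"
proof (rule ccontr)
  assume "(\<integral>u. Y u \<partial>M) \<notin> S"
  then obtain a b where ab: "inner a (\<integral>u. Y u \<partial>M) < b" "\<And>x. x \<in> S \<Longrightarrow> b < inner a x"
    using separating_hyperplane_closed_point[OF S] by blast
  have "b = (\<integral>u. b \<partial>M)" by (simp add: prob_space)
  also have "\<dots> \<le> (\<integral>u. inner a (Y u) \<partial>M)"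
    using Y ab(2) mem by (intro integral_mono) (auto intro: less_imp_le)
  also have "\<dots> = inner a (\<integral>u. Y u \<partial>M)" using Y by simp
  finally show False using ab(1) by simp
qed

lemma closed_epigraph:
  fixes g :: "'a::euclidean_space \<Rightarrow> real"
  assumes "continuous_on S g" "closed S"
  shows "closed (epigraph S g)"
proof -
  have "epigraph S g = {z \<in> S \<times> UNIV. g (fst z) \<le> snd z}"
    by (auto simp: epigraph_def)
  moreover have "closed {z \<in> S \<times> (UNIV :: real set). g (fst z) \<le> snd z}"
    using assms
    by (intro continuous_on_closed_Collect_le continuous_intros closed_Times
        continuous_on_compose2[OF assms(1)]) auto
  ultimately show ?thesis by simp
qed

lemma
  fixes Y :: "'a \<Rightarrow> 'b::euclidean_space" and h :: "'a \<Rightarrow> real"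
  assumes Y: "integrable M Y" and h: "integrable M h"
  shows integrable_Pair: "integrable M (\<lambda>u. (Y u, h u))"
    and integral_Pair: "(\<integral>u. (Y u, h u) \<partial>M) = (\<integral>u. Y u \<partial>M, \<integral>u. h u \<partial>M)"
proof -
  have "bounded_linear (\<lambda>y::'b. (y, 0::real))" "bounded_linear (\<lambda>r::real. (0::'b, r))"
    by (intro bounded_linear_Pair bounded_linear_ident bounded_linear_zero)+
  from integrable_bounded_linear[OF this(1) Y] integrable_bounded_linear[OF this(2) h]
  have "integrable M (\<lambda>u. (Y u, 0) + (0, h u))" by (rule Bochner_Integration.integrable_add)
  then show *: "integrable M (\<lambda>u. (Y u, h u))" by simp
  show "(\<integral>u. (Y u, h u) \<partial>M) = (\<integral>u. Y u \<partial>M, \<integral>u. h u \<partial>M)"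
    using integral_bounded_linear[OF bounded_linear_fst *] integral_bounded_linear[OF bounded_linear_snd *]
    by (simp add: prod_eq_iff)
qed

text \<open>The mean of the points \<open>(Y u, g (Y u))\<close> stays in the epigraph. A supporting
  affine function at the mean is avoided, since a continuous convex function may have no subgradient
  at a relative boundary point of \<open>S\<close>.\<close>

lemma (in prob_space) jensen_convex_on:
  fixes Y :: "'a \<Rightarrow> 'b::euclidean_space" and g :: "'b \<Rightarrow> real"
  assumes S: "closed S" and g: "convex_on S g" "continuous_on S g"
    and Y: "integrable M Y" "integrable M (\<lambda>u. g (Y u))" and mem: "\<And>u. u \<in> space M \<Longrightarrow> Y u \<in> S"
  shows "g (\<integral>u. Y u \<partial>M) \<le> (\<integral>u. g (Y u) \<partial>M)"
proof -
  have "(\<integral>u. (Y u, g (Y u)) \<partial>M) \<in> epigraph S g"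
    using Y mem S g
    by (intro mean_mem_closed_convex closed_epigraph convex_epigraphI integrable_Pair)
       (auto simp: mem_epigraph)
  then show "g (\<integral>u. Y u \<partial>M) \<le> (\<integral>u. g (Y u) \<partial>M)"
    by (auto simp: mem_epigraph integral_Pair[OF Y])
qed

section \<open>Gaussian tilting\<close>

text \<open>A single round in isolation: \<open>l\<close> stands for the cumulative loss times minus
  the step size, \<open>g\<close> for the last revealed loss.\<close>

locale gaussian_tilt = prob_space M for M :: "'a measure" +
  fixes l g :: "'a \<Rightarrow> real" and \<beta> C :: real
  assumes l_meas [measurable]: "l \<in> borel_measurable M"
    and g_meas [measurable]: "g \<in> borel_measurable M"
    and l_bound: "u \<in> space M \<Longrightarrow> \<bar>l u\<bar> \<le> C"
    and g_bound: "u \<in> space M \<Longrightarrow> \<bar>g u\<bar> \<le> 1"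
    and beta: "0 < \<beta>" "\<beta> \<le> 1 / 32"
begin

definition W :: "real \<Rightarrow> 'a \<Rightarrow> real" where
  "W \<theta> u = exp (l u - \<beta> * (g u - \<theta>)\<^sup>2)"

definition Z :: "real \<Rightarrow> real" where
  "Z \<theta> = (\<integral>u. W \<theta> u \<partial>M)"

lemma W_meas [measurable]: "W \<theta> \<in> borel_measurable M"
  unfolding W_def by measurable

lemma W_pos: "0 < W \<theta> u"
  by (simp add: W_def)

lemma W_le: "u \<in> space M \<Longrightarrow> W \<theta> u \<le> exp C"
  using l_bound[of u] beta by (simp add: W_def) (smt (verit) mult_nonneg_nonneg zero_le_power2)

lemma integrable_W_mult:
  assumes [measurable]: "h \<in> borel_measurable M" and h: "\<And>u. u \<in> space M \<Longrightarrow> \<bar>h u\<bar> \<le> K"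
  shows "integrable M (\<lambda>u. W \<theta> u * h u)"
proof (rule integrable_const_bound)
  show "AE u in M. norm (W \<theta> u * h u) \<le> exp C * K"
    using W_le W_pos h by (intro AE_I2) (auto simp: abs_mult less_imp_le intro!: mult_mono)
qed measurable

lemma integrable_W: "integrable M (W \<theta>)"
  using integrable_W_mult[of "\<lambda>_. 1" 1] by simp

lemma Z_pos: "0 < Z \<theta>"
proof -
  define c where "c = exp (- C - \<beta> * (1 + \<bar>\<theta>\<bar>)\<^sup>2)"
  have "c \<le> W \<theta> u" if "u \<in> space M" for u
  proof -
    have "\<bar>g u - \<theta>\<bar> \<le> 1 + \<bar>\<theta>\<bar>" using g_bound[OF that] by linarith
    then have "(g u - \<theta>)\<^sup>2 \<le> (1 + \<bar>\<theta>\<bar>)\<^sup>2"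
      using power_mono[of "\<bar>g u - \<theta>\<bar>" _ 2] by simp
    then have "\<beta> * (g u - \<theta>)\<^sup>2 \<le> \<beta> * (1 + \<bar>\<theta>\<bar>)\<^sup>2" using beta by (intro mult_left_mono) auto
    then show ?thesis using l_bound[OF that] unfolding c_def W_def by simp
  qed
  then have "(\<integral>u. c \<partial>M) \<le> Z \<theta>"
    unfolding Z_def by (intro integral_mono integrable_W) auto
  moreover have "0 < c" by (simp add: c_def)
  ultimately show ?thesis by (simp add: prob_space)
qed

lemma continuous_Z: "continuous_on UNIV Z"
proof (intro continuous_at_imp_continuous_on ballI continuous_at_sequentiallyI)
  fix \<theta> and s :: "nat \<Rightarrow> real" assume s: "s \<longlonglongrightarrow> \<theta>"
  show "(\<lambda>n. Z (s n)) \<longlonglongrightarrow> Z \<theta>"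
    unfolding Z_def
  proof (rule integral_dominated_convergence[where w = "\<lambda>_. exp C"])
    show "AE u in M. (\<lambda>n. W (s n) u) \<longlonglongrightarrow> W \<theta> u"
      unfolding W_def by (intro AE_I2 tendsto_intros s)
    show "AE u in M. norm (W (s n) u) \<le> exp C" for n
      using W_le W_pos by (intro AE_I2) (auto simp: less_imp_le)
  qed (auto simp: integrable_W)
qed

text \<open>Moving an outside center to the nearer endpoint \<open>c\<close> brings it closer to
  every value of \<open>g\<close> at once. The form \<open>1 < c * \<theta>\<close> covers both
  ends, and the factor \<open>\<kappa> < 1\<close> is uniform in \<open>u\<close>, so strictness
  survives integration.\<close>

lemma Z_outside_less:
  assumes c: "c = 1 \<or> c = - 1" and \<theta>: "1 < c * \<theta>"
  shows "Z \<theta> < Z c"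
proof -
  define \<kappa> where "\<kappa> = exp (- \<beta> * (\<theta> - c)\<^sup>2)"
  have "W \<theta> u \<le> \<kappa> * W c u" if "u \<in> space M" for u
  proof -
    have "0 \<le> (c - g u) * (\<theta> - c)"
      using c \<theta> g_bound[OF that] by (auto simp: zero_le_mult_iff)
    then have "(g u - c)\<^sup>2 + (\<theta> - c)\<^sup>2 \<le> (g u - \<theta>)\<^sup>2"
      by (simp add: power2_eq_square algebra_simps)
    then have "\<beta> * ((g u - c)\<^sup>2 + (\<theta> - c)\<^sup>2) \<le> \<beta> * (g u - \<theta>)\<^sup>2"
      using beta by (intro mult_left_mono) auto
    then show ?thesis
      unfolding \<kappa>_def W_def exp_add[symmetric] by (simp add: algebra_simps)
  qed
  then have "Z \<theta> \<le> (\<integral>u. \<kappa> * W c u \<partial>M)"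
    unfolding Z_def by (intro integral_mono integrable_W integrable_mult_right) auto
  also have "\<dots> = \<kappa> * Z c" by (simp add: Z_def)
  also have "\<dots> < 1 * Z c"
  proof (rule mult_strict_right_mono)
    show "\<kappa> < 1" using c \<theta> beta by (auto simp: \<kappa>_def)
  qed (rule Z_pos)
  finally show ?thesis by simp
qed

text \<open>Two distinct maximizers would be beaten by their midpoint. As before, a factor
  \<open>\<kappa> < 1\<close> independent of \<open>u\<close> makes the integrated inequality
  strict.\<close>

lemma Z_midpoint:
  assumes \<theta>: "\<bar>\<theta>1\<bar> \<le> 1" "\<bar>\<theta>2\<bar> \<le> 1" "\<theta>1 \<noteq> \<theta>2"
  shows "min (Z \<theta>1) (Z \<theta>2) < Z ((\<theta>1 + \<theta>2) / 2)"
proof -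
  define m \<delta> where "m = (\<theta>1 + \<theta>2) / 2" and "\<delta> = (\<theta>1 - \<theta>2) / 2"
  define \<kappa> where "\<kappa> = exp (- \<beta> * \<delta>\<^sup>2 / 2)"
  have \<delta>: "\<bar>\<delta>\<bar> \<le> 1" "\<delta> \<noteq> 0" using \<theta> by (auto simp: \<delta>_def)
  have "W \<theta>1 u + W \<theta>2 u \<le> 2 * \<kappa> * W m u" if "u \<in> space M" for u
  proof -
    have "\<bar>g u - m\<bar> \<le> 2" using g_bound[OF that] \<theta> unfolding m_def abs_le_iff by (auto simp: field_simps)
    from gaussian_midpoint[OF beta this \<delta>(1)]
    have "exp (l u) * (exp (- \<beta> * (g u - m - \<delta>)\<^sup>2) + exp (- \<beta> * (g u - m + \<delta>)\<^sup>2))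
        \<le> exp (l u) * (2 * exp (- \<beta> * \<delta>\<^sup>2 / 2) * exp (- \<beta> * (g u - m)\<^sup>2))"
      by (intro mult_left_mono) auto
    moreover have "g u - m - \<delta> = g u - \<theta>1" "g u - m + \<delta> = g u - \<theta>2"
      by (auto simp: m_def \<delta>_def field_simps)
    moreover have "W \<theta> u = exp (l u) * exp (- \<beta> * (g u - \<theta>)\<^sup>2)" for \<theta>
      by (simp add: W_def exp_add[symmetric])
    ultimately show ?thesis by (simp add: \<kappa>_def distrib_left mult_ac)
  qed
  then have "(\<integral>u. W \<theta>1 u + W \<theta>2 u \<partial>M) \<le> (\<integral>u. 2 * \<kappa> * W m u \<partial>M)"
    by (intro integral_mono integrable_W integrable_mult_right Bochner_Integration.integrable_add) auto
  then have "Z \<theta>1 + Z \<theta>2 \<le> 2 * (\<kappa> * Z m)"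
    by (simp add: Z_def integrable_W)
  also have "\<dots> < 2 * (1 * Z m)"
  proof (intro mult_strict_left_mono mult_strict_right_mono Z_pos)
    show "\<kappa> < 1" using \<delta> beta by (simp add: \<kappa>_def)
  qed simp
  finally show ?thesis by (simp add: m_def)
qed

lemma ex1_arg_max: "\<exists>!\<theta>. is_arg_max (\<lambda>\<theta>. ln (Z \<theta>)) (\<lambda>_. True) \<theta>"
  and arg_max_bound: "is_arg_max (\<lambda>\<theta>. ln (Z \<theta>)) (\<lambda>_. True) \<theta> \<Longrightarrow> \<bar>\<theta>\<bar> \<le> 1"
  and arg_max_ge: "is_arg_max (\<lambda>\<theta>. ln (Z \<theta>)) (\<lambda>_. True) \<theta> \<Longrightarrow> Z \<theta>' \<le> Z \<theta>"
proof -
  have arg: "is_arg_max (\<lambda>\<theta>. ln (Z \<theta>)) (\<lambda>_. True) \<theta> \<longleftrightarrow> (\<forall>\<theta>'. Z \<theta>' \<le> Z \<theta>)" for \<theta>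
    using Z_pos by (auto simp: is_arg_max_def not_less)
  have bnd: "\<bar>\<theta>\<bar> \<le> 1" if "\<forall>\<theta>'. Z \<theta>' \<le> Z \<theta>" for \<theta>
  proof (rule ccontr)
    assume "\<not> \<bar>\<theta>\<bar> \<le> 1"
    then consider "1 < 1 * \<theta>" | "1 < - 1 * \<theta>" by (auto simp: abs_if split: if_splits)
    then show False using Z_outside_less[of 1 \<theta>] Z_outside_less[of "- 1" \<theta>] that
      by cases (auto simp: not_less[symmetric])
  qed
  obtain \<theta>0 where \<theta>0: "\<theta>0 \<in> {-1..1}" "\<And>\<theta>. \<theta> \<in> {-1..1} \<Longrightarrow> Z \<theta> \<le> Z \<theta>0"
    using continuous_attains_sup[OF compact_Icc, of "-1" 1 Z]
      continuous_on_subset[OF continuous_Z] by auto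
  have "Z \<theta> \<le> Z \<theta>0" for \<theta>
  proof -
    consider "1 < 1 * \<theta>" | "1 < - 1 * \<theta>" | "\<theta> \<in> {-1..1}" by fastforce
    then show ?thesis
      using Z_outside_less[of 1 \<theta>] Z_outside_less[of "- 1" \<theta>] \<theta>0(2)[of 1] \<theta>0(2)[of "- 1"] \<theta>0(2)[of \<theta>]
      by cases auto
  qed
  moreover have "\<theta>1 = \<theta>2" if "\<forall>\<theta>'. Z \<theta>' \<le> Z \<theta>1" "\<forall>\<theta>'. Z \<theta>' \<le> Z \<theta>2" for \<theta>1 \<theta>2
    using Z_midpoint[of \<theta>1 \<theta>2] bnd that by (metis min_less_iff_disj not_less)
  ultimately show "\<exists>!\<theta>. is_arg_max (\<lambda>\<theta>. ln (Z \<theta>)) (\<lambda>_. True) \<theta>"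
    unfolding arg by blast
  show "is_arg_max (\<lambda>\<theta>. ln (Z \<theta>)) (\<lambda>_. True) \<theta> \<Longrightarrow> \<bar>\<theta>\<bar> \<le> 1"
    using bnd arg by blast
  show "is_arg_max (\<lambda>\<theta>. ln (Z \<theta>)) (\<lambda>_. True) \<theta> \<Longrightarrow> Z \<theta>' \<le> Z \<theta>"
    using arg by blast
qed

text \<open>First-order optimality, from \<open>exp x \<ge> 1 + x\<close> instead of differentiation under the integral.\<close>

lemma centered_at_max:
  assumes \<theta>: "\<bar>\<theta>\<bar> \<le> 1" and max: "\<And>\<theta>'. Z \<theta>' \<le> Z \<theta>"
  shows "(\<integral>u. W \<theta> u * (g u - \<theta>) \<partial>M) = 0"
proof -
  define m where "m = (\<integral>u. W \<theta> u * (g u - \<theta>) \<partial>M) / Z \<theta>"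
  have xi: "\<bar>g u - \<theta>\<bar> \<le> 2" if "u \<in> space M" for u using g_bound[OF that] \<theta> by linarith
  note int = integrable_W_mult[of "\<lambda>u. g u - \<theta>" 2, OF _ xi, simplified]
  have key: "1 + 2 * \<beta> * \<delta> * m \<le> exp (\<beta> * \<delta>\<^sup>2)" for \<delta>
  proof -
    \<comment> \<open>Completing the square: tilting \<open>W \<theta>\<close> by
      \<open>exp (2 * \<beta> * \<delta> * (g u - \<theta>))\<close> shifts the center by
      \<open>\<delta>\<close>, up to the constant
      \<open>exp (\<beta> * \<delta>\<^sup>2)\<close>.\<close>
    have "W \<theta> u + 2 * \<beta> * \<delta> * (W \<theta> u * (g u - \<theta>)) \<le> exp (\<beta> * \<delta>\<^sup>2) * W (\<theta> + \<delta>) u" for u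
    proof -
      have "W \<theta> u * (1 + 2 * \<beta> * \<delta> * (g u - \<theta>)) \<le> W \<theta> u * exp (2 * \<beta> * \<delta> * (g u - \<theta>))"
        using W_pos by (intro mult_left_mono exp_ge_add_one_self) (auto simp: less_imp_le)
      also have "\<dots> = exp (\<beta> * \<delta>\<^sup>2) * W (\<theta> + \<delta>) u"
        unfolding W_def exp_add[symmetric] by (simp add: power2_eq_square algebra_simps)
      finally show ?thesis by (simp add: algebra_simps)
    qed
    then have "(\<integral>u. W \<theta> u + 2 * \<beta> * \<delta> * (W \<theta> u * (g u - \<theta>)) \<partial>M)
        \<le> (\<integral>u. exp (\<beta> * \<delta>\<^sup>2) * W (\<theta> + \<delta>) u \<partial>M)"
      using int by (intro integral_mono integrable_W integrable_mult_right Bochner_Integration.integrable_add) auto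
    then have "Z \<theta> + 2 * \<beta> * \<delta> * (m * Z \<theta>) \<le> exp (\<beta> * \<delta>\<^sup>2) * Z (\<theta> + \<delta>)"
      using int Z_pos[of \<theta>] by (simp add: Z_def integrable_W m_def)
    also have "\<dots> \<le> exp (\<beta> * \<delta>\<^sup>2) * Z \<theta>" using max by simp
    finally have "(1 + 2 * \<beta> * \<delta> * m) * Z \<theta> \<le> exp (\<beta> * \<delta>\<^sup>2) * Z \<theta>" by (simp add: algebra_simps)
    then show ?thesis using Z_pos[of \<theta>] by simp
  qed
  have "m = 0"
  proof (rule ccontr)
    assume "m \<noteq> 0"
    \<comment> \<open>The shift is \<open>\<delta> = \<epsilon> * m\<close>. The bound
      \<open>\<epsilon> \<le> 1\<close> makes the linear gain in \<open>key\<close> at least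
      \<open>2 * y\<close>; the other bound gives \<open>y \<le> 1 / 2\<close>, where
      \<open>exp y \<le> 1 + y + y\<^sup>2\<close> is smaller than \<open>1 + 2 * y\<close>.\<close>
    define \<epsilon> where "\<epsilon> = min 1 (1 / (2 * \<beta> * m\<^sup>2))"
    have \<epsilon>: "0 < \<epsilon>" "\<epsilon> \<le> 1" using \<open>m \<noteq> 0\<close> beta by (auto simp: \<epsilon>_def)
    define y where "y = \<beta> * (\<epsilon> * m)\<^sup>2"
    have "\<epsilon> * (2 * \<beta> * m\<^sup>2) \<le> 1"
      using \<open>m \<noteq> 0\<close> beta unfolding \<epsilon>_def by (simp add: min_def field_simps)
    then have "\<epsilon> * (\<epsilon> * (2 * \<beta> * m\<^sup>2)) \<le> 1 * 1" using \<epsilon> beta by (intro mult_mono) auto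
    then have y1: "0 < y" "2 * y \<le> 1"
      using \<epsilon> beta \<open>m \<noteq> 0\<close> by (simp_all add: y_def power2_eq_square mult_ac)
       (auto simp: zero_less_mult_iff)
    have "\<epsilon> * \<epsilon> \<le> \<epsilon> * 1" using \<epsilon> by (intro mult_left_mono) auto
    then have "2 * y \<le> 2 * \<beta> * (\<epsilon> * m) * m"
      using mult_right_mono[of "\<epsilon> * \<epsilon>" \<epsilon> "\<beta> * m\<^sup>2"] beta by (simp add: y_def power2_eq_square mult_ac)
    with key[of "\<epsilon> * m"] have "1 + 2 * y \<le> exp y" by (simp add: y_def)
    also have "\<dots> \<le> 1 + y + y\<^sup>2" using y1 by (intro exp_bound) auto
    finally have "y \<le> y * y" by (simp add: power2_eq_square)
    then show False using y1 by simp
  qed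
  then show ?thesis using Z_pos[of \<theta>] by (simp add: m_def)
qed

end

section \<open>Homotheties and the uniform distribution\<close>

text \<open>Boxes determine the product measure, and on a box the claim splits into affine changes
  of variables on the line, each contributing one factor \<open>r\<close>. The restricted
  abstraction keeps the map inside \<open>space P\<close>, whose elements are extensional.\<close>

lemma emeasure_PiM_lborel_affine:
  fixes c :: "'i \<Rightarrow> real" and r :: real
  assumes B: "finite B" and r: "0 < r" and A: "A \<in> sets (Pi\<^sub>M B (\<lambda>_. lborel :: real measure))"
  defines "P \<equiv> Pi\<^sub>M B (\<lambda>_. lborel :: real measure)"
  shows "emeasure P A = ennreal (r ^ card B) * emeasure P ((\<lambda>y. \<lambda>b\<in>B. c b + r * y b) -` A \<inter> space P)"
proof -
  interpret product_sigma_finite "\<lambda>_. lborel :: real measure" ..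
  define h where "h = (\<lambda>y. \<lambda>b\<in>B. c b + r * y b)"
  have h [measurable]: "h \<in> measurable P P"
    unfolding h_def P_def by measurable
  define N where "N = density (distr P P h) (\<lambda>_. ennreal (r ^ card B))"
  have N: "emeasure N S = ennreal (r ^ card B) * emeasure P (h -` S \<inter> space P)" if "S \<in> sets P" for S
    using that by (simp add: N_def emeasure_density emeasure_distr nn_integral_cmult)
  have "N = P"
    unfolding P_def
  proof (rule PiM_eqI[OF B])
    show "sets N = sets (Pi\<^sub>M B (\<lambda>_. lborel))" by (simp add: N_def P_def)
    fix E :: "'i \<Rightarrow> real set" assume E: "\<And>i. i \<in> B \<Longrightarrow> E i \<in> sets lborel"
    have S: "Pi\<^sub>E B E \<in> sets P" unfolding P_def using E B by (intro sets_PiM_I_finite) auto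
    have "h -` Pi\<^sub>E B E \<inter> space P = Pi\<^sub>E B (\<lambda>i. (\<lambda>x. c i + r * x) -` E i)"
      by (auto simp: h_def P_def space_PiM PiE_iff)
    moreover have E': "(\<lambda>x. c i + r * x) -` E i \<in> sets lborel" if "i \<in> B" for i
      using measurable_sets[of "\<lambda>x. c i + r * x" borel borel "E i"] E[OF that] by simp
    ultimately have "emeasure N (Pi\<^sub>E B E)
        = ennreal (r ^ card B) * (\<Prod>i\<in>B. emeasure lborel ((\<lambda>x. c i + r * x) -` E i))"
      using N[OF S] emeasure_PiM[OF B, of "\<lambda>i. (\<lambda>x. c i + r * x) -` E i"] by (simp add: P_def)
    also have "ennreal (r ^ card B) = (\<Prod>i\<in>B. ennreal r)" using r by (simp add: ennreal_power)
    also have "\<dots> * (\<Prod>i\<in>B. emeasure lborel ((\<lambda>x. c i + r * x) -` E i))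
        = (\<Prod>i\<in>B. ennreal r * emeasure lborel ((\<lambda>x. c i + r * x) -` E i))"
      by (simp add: prod.distrib)
    also have "\<dots> = (\<Prod>i\<in>B. emeasure lborel (E i))"
    proof (rule prod.cong[OF refl])
      fix i assume i: "i \<in> B"
      have "emeasure lborel (E i)
          = emeasure (density (distr lborel borel (\<lambda>x. c i + r * x)) (\<lambda>_. ennreal \<bar>r\<bar>)) (E i)"
        using lborel_real_affine[of r "c i"] r by simp
      also have "\<dots> = ennreal r * emeasure lborel ((\<lambda>x. c i + r * x) -` E i)"
        using r E[OF i] by (simp add: emeasure_density emeasure_distr nn_integral_cmult)
      finally show "ennreal r * emeasure lborel ((\<lambda>x. c i + r * x) -` E i) = emeasure lborel (E i)" ..
    qed
    finally show "emeasure N (Pi\<^sub>E B E) = (\<Prod>i\<in>B. emeasure lborel (E i))" .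
  qed
  then show ?thesis using N[of A] A by (simp add: P_def h_def)
qed

definition frame_map :: "'a::euclidean_space \<Rightarrow> 'a set \<Rightarrow> ('a \<Rightarrow> real) \<Rightarrow> 'a" where
  "frame_map a B y = a + (\<Sum>b\<in>B. y b *\<^sub>R b)"

lemma frame_map_measurable [measurable]:
  "frame_map a B \<in> borel_measurable (Pi\<^sub>M B (\<lambda>_. lborel))"
  unfolding frame_map_def by measurable

lemma emeasure_affine_lborel:
  assumes "S \<in> sets borel"
  shows "emeasure (affine_lborel a B) S
    = emeasure (Pi\<^sub>M B (\<lambda>_. lborel)) (frame_map a B -` S \<inter> space (Pi\<^sub>M B (\<lambda>_. lborel)))"
proof -
  have "affine_lborel a B = distr (Pi\<^sub>M B (\<lambda>_. lborel)) borel (frame_map a B)"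
    by (simp add: affine_lborel_def frame_map_def[abs_def])
  then show ?thesis using assms by (simp add: emeasure_distr)
qed

lemma sets_affine_lborel [simp, measurable_cong]: "sets (affine_lborel a B) = sets borel"
  by (simp add: affine_lborel_def)

text \<open>As \<open>p\<close> lies in the affine subspace it has coordinates \<open>z\<close>, and
  in coordinates the homothety is
  \<open>y b \<mapsto> (1 - \<epsilon>) * z b + \<epsilon> * y b\<close>, an instance of the scaling
  just computed.\<close>

lemma emeasure_affine_lborel_homothety:
  fixes p :: "'a::euclidean_space"
  assumes B: "finite B" and p: "p \<in> (+) a ` span B" and \<epsilon>: "0 < \<epsilon>" and S: "compact S"
  shows "emeasure (affine_lborel a B) ((\<lambda>v. (1 - \<epsilon>) *\<^sub>R p + \<epsilon> *\<^sub>R v) ` S)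
    = ennreal (\<epsilon> ^ card B) * emeasure (affine_lborel a B) S"
proof -
  define P where "P = Pi\<^sub>M B (\<lambda>_. lborel :: real measure)"
  let ?H = "(\<lambda>v. (1 - \<epsilon>) *\<^sub>R p + \<epsilon> *\<^sub>R v) ` S"
  obtain z where z: "p = frame_map a B z"
    using p span_finite[OF B] by (auto simp: frame_map_def)
  have "compact ?H" by (intro compact_continuous_image continuous_intros S)
  then have sets: "?H \<in> sets borel" "S \<in> sets borel" using S by (auto intro: borel_compact)
  define c where "c = (\<lambda>b. (1 - \<epsilon>) * z b)"
  define h where "h = (\<lambda>y. \<lambda>b\<in>B. c b + \<epsilon> * y b)"
  have fm: "frame_map a B (h y) = (1 - \<epsilon>) *\<^sub>R p + \<epsilon> *\<^sub>R frame_map a B y" for y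
    by (simp add: frame_map_def z h_def c_def algebra_simps sum.distrib scaleR_sum_right sum_subtractf)
  have mem: "(1 - \<epsilon>) *\<^sub>R p + \<epsilon> *\<^sub>R v \<in> ?H \<longleftrightarrow> v \<in> S" for v
    using \<epsilon> by auto
  have "h -` (frame_map a B -` ?H \<inter> space P) \<inter> space P = frame_map a B -` S \<inter> space P"
    using fm mem by (auto simp: P_def space_PiM h_def)
  moreover have "frame_map a B -` ?H \<inter> space P \<in> sets P"
    using measurable_sets[OF frame_map_measurable sets(1)] by (simp add: P_def)
  ultimately show ?thesis
    using emeasure_PiM_lborel_affine[OF B \<epsilon>, of "frame_map a B -` ?H \<inter> space P" c]
      emeasure_affine_lborel[OF sets(1), of a B] emeasure_affine_lborel[OF sets(2), of a B]
    by (simp add: P_def h_def)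
qed

section \<open>Volume of a convex body in frame coordinates\<close>

lemma affine_frame_finite:
  fixes X :: "'a::euclidean_space set"
  assumes "affine_frame X a B"
  shows "finite B" "int (card B) = aff_dim X"
proof -
  have "independent B"
    using assms unfolding affine_frame_def by (intro pairwise_orthogonal_independent) auto
  then show "finite B" by (rule finiteI_independent)
  have "aff_dim X = aff_dim ((+) a ` span B)"
    using assms unfolding affine_frame_def by (metis aff_dim_affine_hull)
  also have "\<dots> = int (dim (span B))"
    by (simp add: aff_dim_translation_eq aff_dim_subspace)
  also have "\<dots> = int (card B)" using \<open>independent B\<close> by (simp add: dim_eq_card_independent)
  finally show "int (card B) = aff_dim X" ..
qed

lemma frame_map_inner:
  assumes "affine_frame X a B" "b \<in> B"
  shows "(frame_map a B y - a) \<bullet> b = y b"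
proof -
  have fin: "finite B" by (rule affine_frame_finite[OF assms(1)])
  have "(frame_map a B y - a) \<bullet> b = (\<Sum>b'\<in>B. y b' * (b' \<bullet> b))"
    by (simp add: frame_map_def inner_sum_left)
  also have "\<dots> = (\<Sum>b'\<in>B. if b' = b then y b else 0)"
    using assms by (intro sum.cong refl)
      (auto simp: affine_frame_def pairwise_def orthogonal_def norm_eq_1)
  finally show ?thesis using fin assms(2) by simp
qed

text \<open>Makes the normalization in \<open>uniform_on\<close> meaningful. Boundedness puts the
  coordinates of \<open>X\<close> into a box; a relative interior point supplies a cube
  inside.\<close>

lemma emeasure_affine_lborel_compact:
  assumes X: "compact X" "convex X" "X \<noteq> {}" and frame: "affine_frame X a B"
  shows "emeasure (affine_lborel a B) X \<noteq> 0" "emeasure (affine_lborel a B) X \<noteq> \<infinity>"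
proof -
  interpret product_sigma_finite "\<lambda>_. lborel :: real measure" ..
  define P where "P = Pi\<^sub>M B (\<lambda>_. lborel :: real measure)"
  have fin: "finite B" by (rule affine_frame_finite[OF frame])
  have B1: "norm b = 1" if "b \<in> B" for b using frame that by (simp add: affine_frame_def)
  have Xb: "X \<in> sets borel" using X by (auto intro: borel_compact)
  let ?X = "frame_map a B -` X \<inter> space P"
  have em: "emeasure (affine_lborel a B) X = emeasure P ?X"
    using emeasure_affine_lborel[OF Xb] by (simp add: P_def)
  have meas: "?X \<in> sets P" using measurable_sets[OF frame_map_measurable Xb] by (simp add: P_def)
  have box: "emeasure P (Pi\<^sub>E B (\<lambda>b. {l b..u b})) = (\<Prod>b\<in>B. ennreal (u b - l b))"
    if "\<And>b. b \<in> B \<Longrightarrow> l b \<le> u b" for l u :: "'a \<Rightarrow> real"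
    using that by (simp add: P_def emeasure_PiM[OF fin])
  obtain R where R: "\<And>x. x \<in> X \<Longrightarrow> norm x \<le> R"
    using compact_imp_bounded[OF X(1)] by (auto simp: bounded_iff)
  then have "0 \<le> R" using X(3) by (metis all_not_in_conv norm_ge_zero order_trans)
  define K where "K = R + norm a"
  have "?X \<subseteq> Pi\<^sub>E B (\<lambda>_. {- K..K})"
  proof
    fix y assume y: "y \<in> ?X"
    have "\<bar>y b\<bar> \<le> K" if "b \<in> B" for b
    proof -
      have "\<bar>y b\<bar> \<le> norm (frame_map a B y - a) * norm b"
        unfolding frame_map_inner[OF frame that, of y, symmetric] by (rule Cauchy_Schwarz_ineq2)
      also have "\<dots> \<le> norm (frame_map a B y) + norm a"
        using B1[OF that] norm_triangle_ineq4 by simp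
      also have "\<dots> \<le> K" using R y by (simp add: K_def)
      finally show ?thesis .
    qed
    then have "y b \<in> {- K..K}" if "b \<in> B" for b
      using that by (metis abs_le_iff atLeastAtMost_iff minus_le_iff)
    moreover have "y \<in> extensional B" using y by (auto simp: P_def space_PiM PiE_iff)
    ultimately show "y \<in> Pi\<^sub>E B (\<lambda>_. {- K..K})" by (simp add: PiE_iff)
  qed
  then have "emeasure P ?X \<le> emeasure P (Pi\<^sub>E B (\<lambda>_. {- K..K}))"
    unfolding P_def using fin by (intro emeasure_mono sets_PiM_I_finite) auto
  also have "\<dots> < \<infinity>"
    using box[of "\<lambda>_. - K" "\<lambda>_. K"] \<open>0 \<le> R\<close>
    by (simp add: K_def power_less_top_ennreal)
  finally show "emeasure (affine_lborel a B) X \<noteq> \<infinity>" using em by simp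
  obtain p where "p \<in> rel_interior X" using rel_interior_eq_empty X by blast
  then obtain e where p: "p \<in> X" and e: "e > 0" "cball p e \<inter> affine hull X \<subseteq> X"
    unfolding mem_rel_interior_cball by blast
  have hull: "affine hull X = (+) a ` span B" using frame by (simp add: affine_frame_def)
  then have "p \<in> (+) a ` span B" using p hull_inc[of p X] by blast
  then obtain z where z: "p = frame_map a B z"
    using span_finite[OF fin] by (auto simp: frame_map_def)
  \<comment> \<open>By the triangle inequality, a cube of half side \<open>r\<close> reaches at most
    \<open>card B * r\<close> from its center. The added 1 keeps the quotient positive for an empty
    \<open>B\<close>.\<close>
  define r where "r = e / (real (card B) + 1)"
  have r: "0 < r" "real (card B) * r \<le> e" using e by (auto simp: r_def field_simps)
  have sub: "Pi\<^sub>E B (\<lambda>b. {z b - r..z b + r}) \<subseteq> ?X"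
  proof
    fix y assume y: "y \<in> Pi\<^sub>E B (\<lambda>b. {z b - r..z b + r})"
    have ybd: "\<bar>y b - z b\<bar> \<le> r" if "b \<in> B" for b
      using PiE_mem[OF y that] by (auto simp: abs_le_iff)
    have "norm (frame_map a B y - p) = norm (\<Sum>b\<in>B. (y b - z b) *\<^sub>R b)"
      by (simp add: z frame_map_def scaleR_diff_left sum_subtractf)
    also have "\<dots> \<le> (\<Sum>b\<in>B. r)"
      using ybd B1 by (intro sum_norm_le) simp
    also have "\<dots> \<le> e" using r by simp
    finally have "frame_map a B y \<in> cball p e" by (simp add: dist_norm norm_minus_commute)
    moreover have "frame_map a B y \<in> affine hull X"
      unfolding hull frame_map_def by (intro imageI span_sum span_scale span_base)
    ultimately show "y \<in> ?X" using e y by (auto simp: P_def space_PiM PiE_iff)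
  qed
  have "0 < (\<Prod>b\<in>B. ennreal ((z b + r) - (z b - r)))"
    using r fin by (simp add: ennreal_power)
  also have "\<dots> = emeasure P (Pi\<^sub>E B (\<lambda>b. {z b - r..z b + r}))" using r by (subst box) auto
  also have "\<dots> \<le> emeasure P ?X" using sub meas by (rule emeasure_mono)
  finally show "emeasure (affine_lborel a B) X \<noteq> 0" using em by simp
qed

text \<open>These facts are all that the regret analysis uses about the uniform distribution; none
  of them mentions the frame hidden in \<open>uniform_on\<close>.\<close>

lemma
  fixes X :: "'a::euclidean_space set"
  assumes X: "X \<noteq> {}" "compact X" "convex X" and d: "aff_dim X = int d" and \<mu>: "uniform_on X \<mu>"
  shows uniform_on_prob_space: "prob_space \<mu>"
    and space_uniform_on: "space \<mu> = X"
    and sets_uniform_on: "sets \<mu> = sets (restrict_space borel X)"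
    and homothety_in_sets_uniform_on:
      "\<And>\<epsilon> p. 0 < \<epsilon> \<Longrightarrow> \<epsilon> \<le> 1 \<Longrightarrow> p \<in> X \<Longrightarrow> (\<lambda>v. (1 - \<epsilon>) *\<^sub>R p + \<epsilon> *\<^sub>R v) ` X \<in> sets \<mu>"
    and measure_uniform_on_homothety:
      "\<And>\<epsilon> p. 0 < \<epsilon> \<Longrightarrow> \<epsilon> \<le> 1 \<Longrightarrow> p \<in> X \<Longrightarrow>
        measure \<mu> ((\<lambda>v. (1 - \<epsilon>) *\<^sub>R p + \<epsilon> *\<^sub>R v) ` X) = \<epsilon> ^ d"
proof -
  obtain a B where frame: "affine_frame X a B"
    and \<mu>_def: "\<mu> = restrict_space (uniform_measure (affine_lborel a B) X) X"
    using \<mu> unfolding uniform_on_def by blast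
  let ?L = "affine_lborel a B"
  have Xb [measurable]: "X \<in> sets borel" using X by (auto intro: borel_compact)
  note L = emeasure_affine_lborel_compact[OF X(2,3,1) frame]
  have em: "emeasure \<mu> S = emeasure ?L S / emeasure ?L X" if "S \<subseteq> X" "S \<in> sets borel" for S
    using that Xb unfolding \<mu>_def
    by (subst emeasure_restrict_space) (auto simp: Int_absorb1)
  show space: "space \<mu> = X"
    by (simp add: \<mu>_def space_restrict_space sets_eq_imp_space_eq[OF sets_affine_lborel])
  show sets: "sets \<mu> = sets (restrict_space borel X)"
    unfolding \<mu>_def by (intro sets_restrict_space_cong) simp
  have "emeasure \<mu> (space \<mu>) = 1"
    using em[of X] L Xb unfolding space by (simp add: ennreal_divide_self top.not_eq_extremum zero_less_iff_neq_zero)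
  then show "prob_space \<mu>" by (rule prob_spaceI)
  fix \<epsilon> :: real and p assume \<epsilon>: "0 < \<epsilon>" "\<epsilon> \<le> 1" and p: "p \<in> X"
  let ?H = "(\<lambda>v. (1 - \<epsilon>) *\<^sub>R p + \<epsilon> *\<^sub>R v) ` X"
  have HX: "?H \<subseteq> X" using X(3) p \<epsilon> by (auto intro: convexD)
  have Hb: "?H \<in> sets borel"
    using X(2) by (intro borel_compact compact_continuous_image continuous_intros)
  show "?H \<in> sets \<mu>"
    using HX Hb Xb by (simp add: sets sets_restrict_space_iff)
  have "p \<in> (+) a ` span B"
    using frame p hull_inc[of p X] unfolding affine_frame_def by blast
  moreover have "card B = d" using affine_frame_finite(2)[OF frame] d by simp
  ultimately have "emeasure \<mu> ?H = ennreal (\<epsilon> ^ d) * emeasure ?L X / emeasure ?L X"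
    using em[OF HX Hb] emeasure_affine_lborel_homothety[OF affine_frame_finite(1)[OF frame] _ \<epsilon>(1) X(2), of p a]
    by simp
  also have "\<dots> = ennreal (\<epsilon> ^ d)"
    using L by (simp add: ennreal_mult_divide_eq)
  finally show "measure \<mu> ?H = \<epsilon> ^ d" using \<epsilon> by (simp add: measure_def)
qed

section \<open>Regret of the algorithm\<close>

text \<open>The reference measure is a general probability measure on the Borel sets of
  \<open>X\<close>; dimension enters later, through the measure of a homothetic copy.\<close>

locale hedge = prob_space \<mu> for \<mu> :: "'a::euclidean_space measure" +
  fixes X :: "'a set" and f :: "nat \<Rightarrow> 'a \<Rightarrow> real" and T :: nat
  assumes X: "X \<noteq> {}" "compact X" "convex X"
    and space: "space \<mu> = X" and sets: "sets \<mu> = sets (restrict_space borel X)"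
    and f0: "f 0 = (\<lambda>_. 0)"
    and cont: "\<And>t. t \<in> {1..T} \<Longrightarrow> continuous_on X (f t)"
    and conv: "\<And>t. t \<in> {1..T} \<Longrightarrow> convex_on X (f t)"
    and range: "\<And>t. t \<in> {1..T} \<Longrightarrow> f t \<in> X \<rightarrow> {-1..1}"
begin

section \<open>Regularity and size of the losses\<close>

lemma continuous_loss: "t \<le> T \<Longrightarrow> continuous_on X (f t)"
  using cont[of t] by (cases t) (auto simp: f0)

lemma convex_loss: "t \<le> T \<Longrightarrow> convex_on X (f t)"
  using conv[of t] X by (cases t) (auto simp: f0 convex_on_const)

lemma abs_loss_le: "t \<le> T \<Longrightarrow> u \<in> X \<Longrightarrow> \<bar>f t u\<bar> \<le> 1"
  using range[of t] by (cases t) (fastforce simp: f0 Pi_iff abs_le_iff)+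

lemma continuous_cum_loss: "t \<le> T \<Longrightarrow> continuous_on X (cum_loss f t)"
  by (induction t) (auto intro!: continuous_intros continuous_loss)

lemma convex_cum_loss: "t \<le> T \<Longrightarrow> convex_on X (cum_loss f t)"
proof (induction t)
  case 0
  then show ?case using X by (simp add: convex_on_const)
next
  case (Suc t)
  then have "convex_on X (\<lambda>u. (cum_loss f t u + f t u) + f (Suc t) u)"
    by (intro convex_on_add convex_loss) auto
  then show ?case by simp
qed

lemma abs_cum_loss_le: "t \<le> T \<Longrightarrow> u \<in> X \<Longrightarrow> \<bar>cum_loss f t u\<bar> \<le> 2 * real t"
proof (induction t)
  case (Suc t)
  then show ?case using abs_loss_le[of t u] abs_loss_le[of "Suc t" u] by fastforce
qed simp

lemma measurable_continuous_on:
  fixes h :: "'a \<Rightarrow> 'b::topological_space"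
  shows "continuous_on X h \<Longrightarrow> h \<in> borel_measurable \<mu>"
  using borel_measurable_continuous_on_restrict[of X h] sets by (simp cong: measurable_cong_sets)

text \<open>Round \<open>Suc n\<close> is built from the losses up to \<open>n\<close>. The constant
  \<open>real n / 4\<close> is \<open>hedge_eta\<close> times the bound \<open>2 * real n\<close> on
  the cumulative loss.\<close>

lemma gaussian_tilt:
  assumes "n \<le> T"
  shows "gaussian_tilt \<mu> (\<lambda>u. - (hedge_eta * cum_loss f n u)) (f n) hedge_beta (real n / 4)"
proof
  show "(\<lambda>u. - (hedge_eta * cum_loss f n u)) \<in> borel_measurable \<mu>" "f n \<in> borel_measurable \<mu>"
    using assms by (auto intro!: measurable_continuous_on continuous_intros continuous_cum_loss continuous_loss)
qed (use assms abs_cum_loss_le[of n] abs_loss_le[of n] in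
      \<open>auto simp: space hedge_eta_def hedge_beta_def abs_mult mult.commute\<close>)

text \<open>Indexed by the number of revealed losses, so \<open>partition_fun n\<close> belongs to
  round \<open>Suc n\<close> and \<open>partition_fun T\<close> to a round that is never
  played.\<close>

definition partition_fun :: "nat \<Rightarrow> real \<Rightarrow> real" where
  "partition_fun n \<theta> = (\<integral>u. hedge_weight f (Suc n) \<theta> u \<partial>\<mu>)"

abbreviation center :: "nat \<Rightarrow> real" where
  "center n \<equiv> hedge_theta \<mu> f (Suc n)"

lemma
  assumes n: "n \<le> T"
  shows integrable_weight_mult: "\<And>h K \<theta>. h \<in> borel_measurable \<mu> \<Longrightarrow> (\<And>u. u \<in> X \<Longrightarrow> \<bar>h u\<bar> \<le> K) \<Longrightarrow>
      integrable \<mu> (\<lambda>u. hedge_weight f (Suc n) \<theta> u * h u)"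
    and integrable_weight: "\<And>\<theta>. integrable \<mu> (hedge_weight f (Suc n) \<theta>)"
    and partition_fun_pos: "\<And>\<theta>. 0 < partition_fun n \<theta>"
    and abs_center_le: "\<bar>center n\<bar> \<le> 1"
    and integral_weight_xi: "(\<integral>u. hedge_weight f (Suc n) (center n) u * hedge_xi \<mu> f (Suc n) u \<partial>\<mu>) = 0"
proof -
  interpret g: gaussian_tilt \<mu> "\<lambda>u. - (hedge_eta * cum_loss f n u)" "f n" hedge_beta "real n / 4"
    by (rule gaussian_tilt[OF n])
  have W: "hedge_weight f (Suc n) \<theta> = g.W \<theta>" for \<theta>
    by (auto simp: hedge_weight_def g.W_def)
  have Z: "partition_fun n = g.Z"
    by (auto simp: partition_fun_def g.Z_def W)
  have "is_arg_max (\<lambda>\<theta>. ln (g.Z \<theta>)) (\<lambda>_. True) (center n)"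
    using theI'[OF g.ex1_arg_max] unfolding hedge_theta_def W g.Z_def .
  note max = g.arg_max_bound[OF this] g.arg_max_ge[OF this]
  show "integrable \<mu> (\<lambda>u. hedge_weight f (Suc n) \<theta> u * h u)"
    if "h \<in> borel_measurable \<mu>" "\<And>u. u \<in> X \<Longrightarrow> \<bar>h u\<bar> \<le> K" for h K \<theta>
    using g.integrable_W_mult[OF that(1), of K \<theta>] that(2) by (simp add: W space)
  show "integrable \<mu> (hedge_weight f (Suc n) \<theta>)" "0 < partition_fun n \<theta>" for \<theta>
    using g.integrable_W g.Z_pos by (simp_all add: W Z)
  show "\<bar>center n\<bar> \<le> 1" by (rule max(1))
  show "(\<integral>u. hedge_weight f (Suc n) (center n) u * hedge_xi \<mu> f (Suc n) u \<partial>\<mu>) = 0"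
    using g.centered_at_max[OF max] by (simp add: W hedge_xi_def)
qed

section \<open>The distribution of a round and its mean\<close>

definition play_density :: "nat \<Rightarrow> 'a \<Rightarrow> real" where
  "play_density n u = hedge_weight f (Suc n) (center n) u / partition_fun n (center n)
     * (1 - hedge_xi \<mu> f (Suc n) u / 2)"

lemma weight_measurable: "n \<le> T \<Longrightarrow> hedge_weight f (Suc n) \<theta> \<in> borel_measurable \<mu>"
  using integrable_weight by blast

lemma xi_measurable: "n \<le> T \<Longrightarrow> hedge_xi \<mu> f (Suc n) \<in> borel_measurable \<mu>"
  unfolding hedge_xi_def
  by (auto intro!: measurable_continuous_on continuous_intros continuous_loss)

lemma abs_xi_le: "n \<le> T \<Longrightarrow> u \<in> X \<Longrightarrow> \<bar>hedge_xi \<mu> f (Suc n) u\<bar> \<le> 2"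
  using abs_loss_le[of n u] abs_center_le[of n] by (simp add: hedge_xi_def)

lemma play_density_measurable: "n \<le> T \<Longrightarrow> play_density n \<in> borel_measurable \<mu>"
  using weight_measurable[of n "center n"] xi_measurable[of n] unfolding play_density_def by simp

lemma play_density_nonneg: "n \<le> T \<Longrightarrow> u \<in> X \<Longrightarrow> 0 \<le> play_density n u"
  using abs_xi_le[of n u] partition_fun_pos[of n "center n"]
  by (auto simp: play_density_def hedge_weight_def intro!: mult_nonneg_nonneg)

lemma integrable_play_density_mult:
  assumes n: "n \<le> T" and h: "h \<in> borel_measurable \<mu>" "\<And>u. u \<in> X \<Longrightarrow> \<bar>h u\<bar> \<le> K"
  shows "integrable \<mu> (\<lambda>u. play_density n u * h u)"
proof -
  have "integrable \<mu> (\<lambda>u. hedge_weight f (Suc n) (center n) u * ((1 - hedge_xi \<mu> f (Suc n) u / 2) * h u))"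
  proof (rule integrable_weight_mult[OF n])
    show "\<bar>(1 - hedge_xi \<mu> f (Suc n) u / 2) * h u\<bar> \<le> 2 * K" if "u \<in> X" for u
      unfolding abs_mult using abs_xi_le[OF n that] h(2)[OF that] by (intro mult_mono) auto
  qed (use h xi_measurable[OF n] in simp)
  then have "integrable \<mu> (\<lambda>u. (1 / partition_fun n (center n)) *
      (hedge_weight f (Suc n) (center n) u * ((1 - hedge_xi \<mu> f (Suc n) u / 2) * h u)))"
    by (rule integrable_mult_right)
  then show ?thesis by (simp add: play_density_def mult_ac)
qed

text \<open>Here the maximality of the center is spent: \<open>integral_weight_xi\<close> removes
  the contribution of the tilt and leaves the normalized weight.\<close>

lemma integral_play_density:
  assumes n: "n \<le> T"
  shows "(\<integral>u. play_density n u \<partial>\<mu>) = 1"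
proof -
  let ?w = "hedge_weight f (Suc n) (center n)" and ?\<xi> = "hedge_xi \<mu> f (Suc n)"
  have int: "integrable \<mu> ?w" "integrable \<mu> (\<lambda>u. ?w u * ?\<xi> u)"
    using integrable_weight[OF n] integrable_weight_mult[OF n xi_measurable[OF n] abs_xi_le[OF n]] by auto
  have "(\<integral>u. play_density n u \<partial>\<mu>)
      = (\<integral>u. (?w u - (?w u * ?\<xi> u) / 2) / partition_fun n (center n) \<partial>\<mu>)"
    by (simp add: play_density_def algebra_simps)
  also have "\<dots> = 1"
    using int integral_weight_xi[OF n] partition_fun_pos[OF n, of "center n"]
    by (simp add: partition_fun_def[symmetric])
  finally show ?thesis .
qed

text \<open>Each \<open>ennreal\<close> in the nested densities truncates at 0; on \<open>X\<close>
  both factors are nonnegative, so they merge into one.\<close>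

lemma hedge_Q_eq:
  assumes n: "n \<le> T"
  shows "hedge_Q \<mu> f (Suc n) = density \<mu> (\<lambda>u. ennreal (play_density n u))"
proof -
  note [measurable] = weight_measurable[OF n] xi_measurable[OF n]
  have "hedge_Q \<mu> f (Suc n) = density \<mu> (\<lambda>u.
      ennreal (hedge_weight f (Suc n) (center n) u / partition_fun n (center n))
        * ennreal (1 - hedge_xi \<mu> f (Suc n) u / 2))"
    unfolding hedge_Q_def hedge_P_def partition_fun_def[symmetric]
    by (subst density_density_eq) (auto simp: hedge_P_def)
  also have "\<dots> = density \<mu> (\<lambda>u. ennreal (play_density n u))"
  proof (rule density_cong)
    have "ennreal (hedge_weight f (Suc n) (center n) u / partition_fun n (center n))
        * ennreal (1 - hedge_xi \<mu> f (Suc n) u / 2) = ennreal (play_density n u)" if "u \<in> X" for u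
      using partition_fun_pos[OF n, of "center n"] abs_xi_le[OF n that]
      unfolding play_density_def by (subst ennreal_mult) (auto simp: hedge_weight_def)
    then show "AE u in \<mu>. ennreal (hedge_weight f (Suc n) (center n) u / partition_fun n (center n))
        * ennreal (1 - hedge_xi \<mu> f (Suc n) u / 2) = ennreal (play_density n u)"
      by (intro AE_I2) (simp add: space)
  qed (use play_density_measurable[OF n] in measurable)
  finally show ?thesis .
qed

lemma prob_space_hedge_Q:
  assumes n: "n \<le> T"
  shows "prob_space (hedge_Q \<mu> f (Suc n))"
proof (rule prob_spaceI)
  have "integrable \<mu> (play_density n)"
    using integrable_play_density_mult[OF n, of "\<lambda>_. 1" 1] by simp
  then have "(\<integral>\<^sup>+u. ennreal (play_density n u) \<partial>\<mu>) = 1"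
    using play_density_nonneg[OF n] integral_play_density[OF n]
    by (subst nn_integral_eq_integral) (auto simp: space)
  then show "emeasure (hedge_Q \<mu> f (Suc n)) (space (hedge_Q \<mu> f (Suc n))) = 1"
    using play_density_measurable[OF n] by (simp add: hedge_Q_eq[OF n] emeasure_density)
qed

lemma
  assumes n: "n < T"
  shows hedge_play_mem: "hedge_play \<mu> f (Suc n) \<in> X"
    and hedge_play_jensen: "\<And>g. convex_on X g \<Longrightarrow> continuous_on X g \<Longrightarrow>
      g (hedge_play \<mu> f (Suc n)) \<le> (\<integral>u. play_density n u * g u \<partial>\<mu>)"
proof -
  have n': "n \<le> T" using n by simp
  note [measurable] = play_density_measurable[OF n']
  interpret Q: prob_space "hedge_Q \<mu> f (Suc n)" by (rule prob_space_hedge_Q[OF n'])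
  have space_Q: "space (hedge_Q \<mu> f (Suc n)) = X" by (simp add: hedge_Q_eq[OF n'] space)
  have int: "integrable (hedge_Q \<mu> f (Suc n)) h" if hc: "continuous_on X h"
    for h :: "'a \<Rightarrow> 'c::euclidean_space"
  proof -
    obtain K where "\<forall>u\<in>X. norm (h u) \<le> K"
      using compact_imp_bounded[OF compact_continuous_image[OF hc X(2)]] by (auto simp: bounded_iff)
    then show ?thesis
      using measurable_continuous_on[OF hc]
      by (intro Q.integrable_const_bound[of _ K] AE_I2) (simp_all add: space_Q, simp add: hedge_Q_eq[OF n'])
  qed
  have mem: "u \<in> X" if "u \<in> space (hedge_Q \<mu> f (Suc n))" for u using that space_Q by simp
  show "hedge_play \<mu> f (Suc n) \<in> X"
    unfolding hedge_play_def using X mem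
    by (intro Q.mean_mem_closed_convex compact_imp_closed int continuous_on_id) auto
  fix g assume g: "convex_on X g" "continuous_on X g"
  note J = Q.jensen_convex_on[OF compact_imp_closed[OF X(2)] g int[OF continuous_on_id] int[OF g(2)] mem]
  have "(\<integral>u. g u \<partial>hedge_Q \<mu> f (Suc n)) = (\<integral>u. play_density n u * g u \<partial>\<mu>)"
    unfolding hedge_Q_eq[OF n'] using measurable_continuous_on[OF g(2)] play_density_nonneg[OF n']
    by (subst integral_density) (auto simp: space)
  then show "g (hedge_play \<mu> f (Suc n)) \<le> (\<integral>u. play_density n u * g u \<partial>\<mu>)"
    using J by (simp add: hedge_play_def)
qed

section \<open>Change of the potential in one round\<close>

lemma hedge_step:
  assumes n: "n < T" and \<theta>': "\<bar>\<theta>'\<bar> \<le> 1"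
  shows "hedge_eta * alt_loss f (Suc n) (hedge_play \<mu> f (Suc n))
    \<le> ln (partition_fun n (center n)) - ln (partition_fun (Suc n) \<theta>')"
proof -
  have n': "n \<le> T" "Suc n \<le> T" using n by auto
  define g where "g = (\<lambda>u. f n u + f (Suc n) u)"
  have g: "convex_on X g" "continuous_on X g"
    unfolding g_def using n' by (auto intro!: convex_on_add convex_loss continuous_intros continuous_loss)
  define G where "G = (\<integral>u. play_density n u * g u \<partial>\<mu>)"
  have gG: "alt_loss f (Suc n) (hedge_play \<mu> f (Suc n)) \<le> G"
    using hedge_play_jensen[OF n g] by (simp add: alt_loss_def g_def G_def)
  let ?w = "hedge_weight f (Suc n) (center n)" and ?\<xi> = "hedge_xi \<mu> f (Suc n)"
  define z where "z = partition_fun n (center n)"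
  \<comment> \<open>The elementary inequality speaks of centered losses, the weights of raw ones,
    and \<open>c\<close> is the total offset. Its factor \<open>exp (- c / 8)\<close> cancels once
    \<open>1 + x \<le> exp x\<close> is applied to the integrated bound.\<close>
  define c where "c = center n + \<theta>'"
  have z: "0 < z" using partition_fun_pos[OF n'(1)] by (simp add: z_def)
  have "\<bar>g u\<bar> \<le> 2" if "u \<in> X" for u
    using abs_loss_le[OF n'(1) that] abs_loss_le[OF n'(2) that] by (simp add: g_def)
  then have int: "integrable \<mu> (\<lambda>u. play_density n u * g u)"
    by (rule integrable_play_density_mult[OF n'(1) measurable_continuous_on[OF g(2)]])
  have int1: "integrable \<mu> (play_density n)"
    using integrable_play_density_mult[OF n'(1), of "\<lambda>_. 1" 1] by simp
  have le: "hedge_weight f (Suc (Suc n)) \<theta>' u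
      \<le> exp (- c / 8) * (?w u - z / 8 * (play_density n u * g u - c * play_density n u))"
    if u: "u \<in> X" for u
  proof -
    define a b where "a = ?\<xi> u" and "b = f (Suc n) u - \<theta>'"
    have ab: "- 2 \<le> a" "a \<le> 2" "b \<le> 2"
      using abs_xi_le[OF n'(1) u] abs_loss_le[OF n'(2) u] \<theta>' by (auto simp: a_def b_def)
    have sum: "a + b = g u - c" by (simp add: a_def b_def g_def c_def hedge_xi_def)
    have "hedge_weight f (Suc (Suc n)) \<theta>' u
        = exp (- c / 8) * (?w u * exp (- (a + b) / 8 + (a\<^sup>2 - b\<^sup>2) / 32))"
      unfolding hedge_weight_def exp_add[symmetric] sum
      by (simp add: hedge_eta_def hedge_beta_def a_def b_def hedge_xi_def g_def field_simps)
    also have "\<dots> \<le> exp (- c / 8) * (?w u * (1 - (a + b) * (1 - a / 2) / 8))"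
      by (intro mult_left_mono exp_tilted_le ab) (auto simp: hedge_weight_def)
    \<comment> \<open>The tilted weight \<open>?w u * (1 - a / 2)\<close> is \<open>z\<close> times
      the density of Q, so integration turns the bound into the Q-mean of \<open>g\<close>.\<close>
    also have "?w u * (1 - (a + b) * (1 - a / 2) / 8)
        = ?w u - z / 8 * (play_density n u * g u - c * play_density n u)"
      unfolding sum unfolding play_density_def z_def[symmetric] a_def using z by (simp add: field_simps)
    finally show ?thesis .
  qed
  have "partition_fun (Suc n) \<theta>'
      \<le> (\<integral>u. exp (- c / 8) * (?w u - z / 8 * (play_density n u * g u - c * play_density n u)) \<partial>\<mu>)"
    unfolding partition_fun_def
    using le int int1 integrable_weight[OF n'(1)] integrable_weight[OF n'(2)]
    by (intro integral_mono) (auto simp: space)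
  also have "\<dots> = exp (- c / 8) * (z - z / 8 * (G - c))"
    using int int1 integrable_weight[OF n'(1)] integral_play_density[OF n'(1)]
    by (simp add: G_def partition_fun_def[symmetric] z_def)
  also have "\<dots> = z * (exp (- c / 8) * (1 + (c - G) / 8))" by (simp add: field_simps)
  also have "\<dots> \<le> z * (exp (- c / 8) * exp ((c - G) / 8))"
    using z by (intro mult_left_mono exp_ge_add_one_self) auto
  also have "\<dots> = z * exp (- G / 8)" by (simp add: exp_add[symmetric] field_simps)
  finally have "ln (partition_fun (Suc n) \<theta>') \<le> ln (z * exp (- G / 8))"
    using partition_fun_pos[OF n'(2)] z by (subst ln_le_cancel_iff) auto
  also have "\<dots> = ln z - G / 8" using z by (simp add: ln_mult)
  finally show ?thesis using gG by (simp add: hedge_eta_def z_def)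
qed

text \<open>The last center is left free: the induction step needs the hypothesis at the maximizer
  \<open>center m\<close>, whereas the final application takes 0.\<close>

lemma hedge_sum:
  assumes "m \<le> T" "\<bar>\<theta>\<bar> \<le> 1"
  shows "hedge_eta * (\<Sum>t=1..m. alt_loss f t (hedge_play \<mu> f t)) \<le> - ln (partition_fun m \<theta>)"
  using assms
proof (induction m arbitrary: \<theta>)
  case 0
  \<comment> \<open>Before any loss is revealed the weight is
    \<open>exp (- hedge_beta * \<theta>\<^sup>2)\<close>, which is at most 1 for every
    center.\<close>
  have "partition_fun 0 \<theta> \<le> (\<integral>u. 1 \<partial>\<mu>)"
    unfolding partition_fun_def
    by (intro integral_mono integrable_weight) (auto simp: hedge_weight_def f0 hedge_beta_def)
  then show ?case using partition_fun_pos[of 0 \<theta>] by (simp add: prob_space)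
next
  case (Suc m)
  then have "m < T" "m \<le> T" by auto
  then show ?case
    using Suc.IH[OF \<open>m \<le> T\<close> abs_center_le[OF \<open>m \<le> T\<close>]] hedge_step[OF \<open>m < T\<close> Suc.prems(2)]
    by (simp add: distrib_left)
qed

section \<open>The final potential against a comparator\<close>

lemma ln_partition_fun_ge:
  assumes S: "S \<in> sets \<mu>" "0 < measure \<mu> S" and c: "\<And>u. u \<in> S \<Longrightarrow> cum_loss f T u \<le> c"
  shows "ln (measure \<mu> S) - hedge_eta * c - hedge_beta \<le> ln (partition_fun T 0)"
proof -
  define k where "k = exp (- hedge_eta * c - hedge_beta)"
  have "k * indicator S u \<le> hedge_weight f (Suc T) 0 u" if u: "u \<in> X" for u
  proof (cases "u \<in> S")
    case True
    have "hedge_eta * cum_loss f T u \<le> hedge_eta * c"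
      using c[OF True] by (simp add: hedge_eta_def)
    \<comment> \<open>At center 0 the Gaussian penalty is at most \<open>hedge_beta\<close>; divided
      by \<open>hedge_eta\<close> it becomes the additive 1/4 of the regret bound.\<close>
    moreover have "(f T u)\<^sup>2 \<le> 1" using abs_loss_le[of T u] u by (simp add: abs_square_le_1)
    then have "hedge_beta * (f T u)\<^sup>2 \<le> hedge_beta" by (simp add: hedge_beta_def)
    ultimately show ?thesis using True by (simp add: k_def hedge_weight_def)
  qed (simp add: hedge_weight_def)
  then have "(\<integral>u. k * indicator S u \<partial>\<mu>) \<le> partition_fun T 0"
    unfolding partition_fun_def using S(1)
    by (intro integral_mono integrable_weight integrable_mult_right) (auto simp: space emeasure_eq_measure)
  moreover have "(\<integral>u. k * indicator S u \<partial>\<mu>) = k * measure \<mu> S"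
    using S(1) sets.sets_into_space[OF S(1)] by (simp add: Int_absorb2)
  ultimately have "ln (k * measure \<mu> S) \<le> ln (partition_fun T 0)"
    using S(2) by (intro ln_mono) (auto simp: k_def)
  then show ?thesis using S(2) by (simp add: ln_mult k_def)
qed

lemma cum_loss_eq_sum: "cum_loss f m u = (\<Sum>t=1..m. alt_loss f t u)"
  by (induction m) (auto simp: alt_loss_def)

text \<open>The factor 8 is \<open>1 / hedge_eta\<close>, and \<open>4 * real T\<close> bounds the
  oscillation of the cumulative loss, whose values lie between \<open>- 2 * real T\<close> and
  \<open>2 * real T\<close>.\<close>

lemma hedge_regret_homothety:
  assumes p: "p \<in> X" and \<epsilon>: "0 < \<epsilon>" "\<epsilon> \<le> 1"
    and H: "(\<lambda>v. (1 - \<epsilon>) *\<^sub>R p + \<epsilon> *\<^sub>R v) ` X \<in> sets \<mu>"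
      "measure \<mu> ((\<lambda>v. (1 - \<epsilon>) *\<^sub>R p + \<epsilon> *\<^sub>R v) ` X) = \<epsilon> ^ d"
  shows "alt_regret f (hedge_play \<mu> f) T p \<le> 8 * real d * ln (1 / \<epsilon>) + 4 * \<epsilon> * real T + 1/4"
proof -
  let ?L = "cum_loss f T"
  have "?L u \<le> ?L p + 4 * \<epsilon> * real T" if "u \<in> (\<lambda>v. (1 - \<epsilon>) *\<^sub>R p + \<epsilon> *\<^sub>R v) ` X" for u
  proof -
    obtain v where v: "v \<in> X" "u = (1 - \<epsilon>) *\<^sub>R p + \<epsilon> *\<^sub>R v" using \<open>u \<in> _\<close> by blast
    have "?L u \<le> (1 - \<epsilon>) * ?L p + \<epsilon> * ?L v"
      unfolding v(2) using convex_onD[OF convex_cum_loss[OF order_refl], of \<epsilon> p v] \<epsilon> p v by simp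
    also have "\<dots> = ?L p + \<epsilon> * (?L v - ?L p)" by (simp add: algebra_simps)
    also have "\<dots> \<le> ?L p + \<epsilon> * (4 * real T)"
      using abs_cum_loss_le[OF order_refl p] abs_cum_loss_le[OF order_refl v(1)] \<epsilon>
      by (intro add_left_mono mult_left_mono) auto
    finally show ?thesis by (simp add: mult_ac)
  qed
  from ln_partition_fun_ge[OF H(1) _ this] H(2) \<epsilon>
  have "real d * ln \<epsilon> - (?L p + 4 * \<epsilon> * real T) / 8 - 1 / 32 \<le> ln (partition_fun T 0)"
    by (simp add: hedge_eta_def hedge_beta_def ln_realpow)
  moreover have "(\<Sum>t=1..T. alt_loss f t (hedge_play \<mu> f t)) / 8 \<le> - ln (partition_fun T 0)"
    using hedge_sum[of T 0] by (simp add: hedge_eta_def)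
  moreover have "alt_regret f (hedge_play \<mu> f) T p
      = (\<Sum>t=1..T. alt_loss f t (hedge_play \<mu> f t)) - ?L p"
    by (simp only: alt_regret_def sum_subtractf cum_loss_eq_sum)
  moreover have "ln (1 / \<epsilon>) = - ln \<epsilon>" using \<epsilon> by (simp add: ln_div)
  ultimately show ?thesis by (simp add: field_simps)
qed

end

theorem theorem8:
  fixes X :: "'a::euclidean_space set"
    and \<mu> :: "'a measure"
    and d T :: nat
    and f :: "nat \<Rightarrow> 'a \<Rightarrow> real"
    and x :: "nat \<Rightarrow> 'a"
  assumes "X \<noteq> {}" "compact X" "convex X"
    and "aff_dim X = int d" "d \<ge> 1"
    and "uniform_on X \<mu>"
    and "T \<ge> 1"
    and "f 0 = (\<lambda>_. 0)"
    and "\<And>t. t \<in> {1..T} \<Longrightarrow> continuous_on X (f t)"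
    and "\<And>t. t \<in> {1..T} \<Longrightarrow> convex_on X (f t)"
    and "\<And>t. t \<in> {1..T} \<Longrightarrow> f t \<in> X \<rightarrow> {-1..1}"
    and "\<And>t. t \<in> {1..T} \<Longrightarrow> x t = hedge_play \<mu> f t"
  shows "\<exists>u\<in>X. (\<forall>v\<in>X. alt_regret f x T v \<le> alt_regret f x T u)
    \<and> alt_regret f x T u \<le> 8 * real d * (1 + log_plus (real T / (2 * real d))) + 1/4
    \<and> alt_regret f x T u \<le> 4 * real T
    \<and> alt_regret f x T u
        \<le> 9 * min (real T) (real d * (1 + log_plus (real T / (2 * real d))))
    \<and> alt_regret f x T u \<le> 18 * (real d * ln (1 + real T / real d))"
proof -
  interpret hedge \<mu> X f T
    using uniform_on_prob_space[OF assms(1-4,6)] space_uniform_on[OF assms(1-4,6)]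
      sets_uniform_on[OF assms(1-4,6)] assms
    by (intro hedge.intro hedge_axioms.intro) auto
  let ?D = "real d" and ?T = "real T"
  let ?A = "?D * (1 + log_plus (?T / (2 * ?D)))"
  have D: "1 \<le> ?D" and T: "1 \<le> ?T" using \<open>d \<ge> 1\<close> \<open>T \<ge> 1\<close> by auto
  have play: "x t \<in> X" if "t \<in> {1..T}" for t
    using that assms(12)[OF that] hedge_play_mem[of "t - 1"]
    by (cases t) auto
  have regret_eq: "alt_regret f x T = alt_regret f (hedge_play \<mu> f) T"
    using assms(12) by (auto simp: alt_regret_def fun_eq_iff intro!: sum.cong)
  have "continuous_on X (\<lambda>v. (\<Sum>t=1..T. alt_loss f t (x t)) - cum_loss f T v)"
    by (intro continuous_intros continuous_cum_loss) simp
  then have "continuous_on X (alt_regret f x T)"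
    by (simp add: alt_regret_def[abs_def] sum_subtractf cum_loss_eq_sum[abs_def])
  then obtain u where u: "u \<in> X" and max: "\<And>v. v \<in> X \<Longrightarrow> alt_regret f x T v \<le> alt_regret f x T u"
    using continuous_attains_sup[OF X(2,1)] by blast
  have R1: "alt_regret f x T u \<le> 8 * ?A + 1/4"
  proof -
    \<comment> \<open>The stationary point of
      \<open>8 * d * ln (1 / \<epsilon>) + 4 * \<epsilon> * T\<close> is \<open>2 * d / T\<close>;
      the cap at 1 keeps the scaled copy inside \<open>X\<close> and produces the truncated
      logarithm.\<close>
    define \<epsilon> where "\<epsilon> = min 1 (2 * ?D / ?T)"
    have \<epsilon>: "0 < \<epsilon>" "\<epsilon> \<le> 1" using D T by (auto simp: \<epsilon>_def)
    have "alt_regret f x T u \<le> 8 * ?D * ln (1 / \<epsilon>) + 4 * \<epsilon> * ?T + 1/4"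
      unfolding regret_eq
      by (intro hedge_regret_homothety u \<epsilon> homothety_in_sets_uniform_on[OF assms(1-4,6)]
          measure_uniform_on_homothety[OF assms(1-4,6)])
    moreover have "\<epsilon> * ?T \<le> 2 * ?D" using T by (simp add: \<epsilon>_def min_def field_simps)
    moreover have "ln (1 / \<epsilon>) \<le> log_plus (?T / (2 * ?D))"
      using D T by (auto simp: \<epsilon>_def min_def log_plus_def)
    then have "8 * ?D * ln (1 / \<epsilon>) \<le> 8 * ?D * log_plus (?T / (2 * ?D))"
      using D by (intro mult_left_mono) auto
    ultimately show ?thesis by (simp add: algebra_simps)
  qed
  have R2: "alt_regret f x T u \<le> 4 * ?T"
  proof -
    have "alt_loss f t (x t) - alt_loss f t u \<le> 4" if t: "t \<in> {1..T}" for t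
    proof -
      have "t \<le> T" "t - 1 \<le> T" using t by auto
      note abs_loss_le[OF this(1) play[OF t]] abs_loss_le[OF this(2) play[OF t]]
        abs_loss_le[OF this(1) u] abs_loss_le[OF this(2) u]
      then show ?thesis unfolding alt_loss_def by linarith
    qed
    then have "alt_regret f x T u \<le> (\<Sum>t=1..T. 4)"
      unfolding alt_regret_def by (rule sum_mono)
    then show ?thesis by simp
  qed
  \<comment> \<open>Since \<open>?A\<close> is at least 1, the additive 1/4 is absorbed by raising
    the factor 8 to 9.\<close>
  have "1 * 1 \<le> ?A" using D by (intro mult_mono) (auto simp: log_plus_def)
  then have R3: "alt_regret f x T u \<le> 9 * min ?T ?A" using R1 R2 by (simp add: min_def)
  have "min ?T ?A = ?D * min (?T / ?D) (1 + log_plus (?T / ?D / 2))"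
    using D by (simp add: min_mult_distrib_left mult.commute)
  also have "\<dots> \<le> ?D * (2 * ln (1 + ?T / ?D))"
    using D T by (intro mult_left_mono min_le_two_ln_add_one) auto
  finally have "alt_regret f x T u \<le> 18 * (?D * ln (1 + ?T / ?D))" using R3 by simp
  with u max R1 R2 R3 show ?thesis by (intro bexI[of _ u] conjI ballI) (auto simp: mult.assoc)
qed

end
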